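(* Suppose problem (RED) described in the context is feasible, and let all quantities be evaluated at an optimal solution $(P,\Delta P)$ of (RED) with optimal Lagrange multipliers. Then the uncertainty payment exactly covers the generation reserve credit and the transmission reserve credit: $$\sum_m\sum_t\Psi_{m,t}=\sum_i\sum_t\Theta^G_{i,t}+\sum_l\sum_t\Theta^T_{l,t},$$ and the mechanism is revenue adequate: for every FTR portfolio satisfying the simultaneous feasibility test, $$\sum_m\sum_t\pi^e_{m,t}d_{m,t}+\sum_m\sum_t\Psi_{m,t}\ \ge\ \sum_i\sum_t\pi^e_{m_i,t}P_{i,t}+\sum_i\sum_t\Theta^G_{i,t}+\sum_t\sum_{m\to n}(\pi^e_{m,t}-\pi^e_{n,t})\,\mathrm{FTR}_{m\to n}.$$
   Context: Data. There are finitely many units $i$, buses $m$ ($N_D$ of them), lines $l$ and time intervals $t\in\{1,\dots,N_T\}$. $\mathcal G(m)$ is the set of units located at bus $m$; unit $i$ is located at exactly one bus $m_i$. Real data: loads $d_{m,t}$, line limits $F_l\ge 0$, shift factors $\Gamma_{l,m}$, capacities $0\le P_i^{\min}\le P_i^{\max}$, ramping limits $r_i^u,r_i^d\ge0$ between sequential intervals, ramping limits $R_i^u,R_i^d\ge 0$ for uncertainty accommodation, initial outputs $P_{i,0}$. The cost functions $C_i^P$ are convex and (piecewise) linear, so that (RED) below is a linear program. Unit commitment variables are fixed at binary values $\hat I_{i,t}$ (on/off), $\hat y_{i,t}$ (start-up), $\hat z_{i,t}$ (shut-down) ($\hat z_{i,N_T+1}$ is also given). $\mathcal K$ is a finite index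 set and $\hat\epsilon^k\in\mathbb R^{N_DN_T}$, $k\in\mathcal K$, are given uncertainty vectors (extreme points of the uncertainty set). Problem (RED): minimize $\sum_t\sum_i C_i^P(P_{i,t})$ over $P_{i,t}$ and $\Delta P^k_{i,t}$ subject to the following constraints (multiplier in parentheses), with $P^{\mathrm{inj}}_{m,t}:=\sum_{i\in\mathcal G(m)}P_{i,t}-d_{m,t}$ and $\Delta P^{\mathrm{inj},k}_{m,t}:=\sum_{i\in\mathcal G(m)}\Delta P^k_{i,t}-\hat\epsilon^k_{m,t}$: - $(\lambda_t)$ $\sum_iP_{i,t}=\sum_md_{m,t}$; - $(\bar\beta_{i,t})$ $P_{i,t}\le\hat I_{i,t}P_i^{\max}$; $(\underline\beta_{i,t})$ $-P_{i,t}\le-\hat I_{i,t}P_i^{\min}$; - $(\bar\alpha_{i,t})$ $P_{i,t}-P_{i,t-1}\le r_i^u(1-\hat y_{i,t})+P_i^{\min}\hat y_{i,t}$; $(\underline\alpha_{i,t})$ $-P_{i,t}+P_{i,t-1}\le r_i^d(1-\hat z_{i,t})+P_i^{\min}\hat z_{i,t}$; - $(\bar\eta_{l,t})$ $\sum_m\Gamma_{l,m}P^{\mathrm{inj}}_{m,t}\le F_l$; $(\underline\eta_{l,t})$ $-\sum_m\Gamma_{l,m}P^{\mathrm{inj}}_{m,t}\le F_l$; and for all $k\in\mathcal K$: - $(\lambda^k_t)$ $\sum_i\Delta P^k_{i,t}=\sum_m\hat\epsilon^k_{m,t}$; - $(\bar\beta^k_{i,t})$ $P_{i,t}+\Delta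 P^k_{i,t}\le\hat I_{i,t}P_i^{\max}$; $(\underline\beta^k_{i,t})$ $-P_{i,t}-\Delta P^k_{i,t}\le-\hat I_{i,t}P_i^{\min}$; - $(\bar\alpha^k_{i,t})$ $\Delta P^k_{i,t}\le R_i^u(1-\hat y_{i,t})$; $(\underline\alpha^k_{i,t})$ $-\Delta P^k_{i,t}\le R_i^d(1-\hat z_{i,t+1})$; - $(\bar\eta^k_{l,t})$ $\sum_m\Gamma_{l,m}(P^{\mathrm{inj}}_{m,t}+\Delta P^{\mathrm{inj},k}_{m,t})\le F_l$; $(\underline\eta^k_{l,t})$ $-\sum_m\Gamma_{l,m}(P^{\mathrm{inj}}_{m,t}+\Delta P^{\mathrm{inj},k}_{m,t})\le F_l$. The Lagrangian is the cost plus $\sum_t\lambda_t(\sum_md_{m,t}-\sum_iP_{i,t})$ plus $\sum_{k,t}\lambda^k_t(\sum_m\hat\epsilon^k_{m,t}-\sum_i\Delta P^k_{i,t})$ plus, for each inequality, its nonnegative multiplier times (left side minus right side). Multipliers are optimal dual (KKT) multipliers. Energy price (LMP): $\pi^e_{m,t}:=\lambda_t-\sum_l\Gamma_{l,m}(\bar\eta_{l,t}-\underline\eta_{l,t})-\sum_l\sum_{k\in\mathcal K}\Gamma_{l,m}(\bar\eta^k_{l,t}-\underline\eta^k_{l,t})$. Uncertainty marginal price (UMP) for $\hat\epsilon^k$: $\pi^{u,k}_{m,t}:=\lambda^k_t-\sum_l\Gamma_{l,m}(\bar\eta^k_{l,t}-\underline\eta^k_{l,t})$. Uncertainty payment at bus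 $m$, time $t$: $\Psi_{m,t}:=\sum_{k\in\mathcal K}\pi^{u,k}_{m,t}\hat\epsilon^k_{m,t}$. Generation reserve credit of unit $i$: $\Theta^G_{i,t}:=\sum_{k\in\mathcal K}\pi^{u,k}_{m_i,t}\Delta P^k_{i,t}$. Transmission reserves: $\Delta f^{\mathrm{pos}}_{l,t}:=F_l-\sum_m\Gamma_{l,m}P^{\mathrm{inj}}_{m,t}$, $\Delta f^{\mathrm{neg}}_{l,t}:=F_l+\sum_m\Gamma_{l,m}P^{\mathrm{inj}}_{m,t}$. Transmission reserve credit: $\Theta^T_{l,t}:=\sum_{k\in\mathcal K}(\bar\eta^k_{l,t}\Delta f^{\mathrm{pos}}_{l,t}+\underline\eta^k_{l,t}\Delta f^{\mathrm{neg}}_{l,t})$. An FTR (financial transmission right) portfolio is a family of real amounts $\mathrm{FTR}_{m\to n}$ over ordered pairs of buses; at time $t$ its holders are credited $\sum_{m\to n}(\pi^e_{m,t}-\pi^e_{n,t})\mathrm{FTR}_{m\to n}$. It satisfies the simultaneous feasibility test (SFT) if $-F_l\le\sum_{m\to n}(\Gamma_{l,m}-\Gamma_{l,n})\mathrm{FTR}_{m\to n}\le F_l$ for all lines $l$. Revenue adequacy means that total payments from loads and uncertainty sources cover total credits to energy, generation reserve and FTR holders. *)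

theory Defs
  imports "HOL-Analysis.Analysis"
begin

text \<open>
  Time intervals are the naturals \<open>1..NT\<close>; all index families are read only on the finite
  carriers \<open>units\<close>, \<open>buses\<close>, \<open>lines\<close>, \<open>scen\<close> and \<open>periods\<close>.
  \<open>Ihat\<close>, \<open>yhat\<close>, \<open>zhat\<close> are the fixed commitment variables (on/off, start-up, shut-down) and
  \<open>eps k m t\<close> is the component at bus \<open>m\<close> and time \<open>t\<close> of the \<open>k\<close>-th uncertainty vector.
\<close>

record ('i, 'm, 'l, 'k) red_data =
  units :: "'i set"
  buses :: "'m set"
  lines :: "'l set"
  scen  :: "'k set"
  NT    :: nat
  bus_of :: "'i \<Rightarrow> 'm"
  load  :: "'m \<Rightarrow> nat \<Rightarrow> real"
  Flim  :: "'l \<Rightarrow> real"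
  Gam   :: "'l \<Rightarrow> 'm \<Rightarrow> real"
  Pmin  :: "'i \<Rightarrow> real"
  Pmax  :: "'i \<Rightarrow> real"
  ramp_up   :: "'i \<Rightarrow> real"
  ramp_down :: "'i \<Rightarrow> real"
  Ramp_up   :: "'i \<Rightarrow> real"  \<comment> \<open>\<open>R\<^sup>u\<close>: limit for uncertainty accommodation\<close>
  Ramp_down :: "'i \<Rightarrow> real"
  P0    :: "'i \<Rightarrow> real"
  gcost :: "'i \<Rightarrow> real \<Rightarrow> real"
  Ihat  :: "'i \<Rightarrow> nat \<Rightarrow> real"
  yhat  :: "'i \<Rightarrow> nat \<Rightarrow> real"
  zhat  :: "'i \<Rightarrow> nat \<Rightarrow> real"
  eps   :: "'k \<Rightarrow> 'm \<Rightarrow> nat \<Rightarrow> real"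

definition periods :: "('i, 'm, 'l, 'k) red_data \<Rightarrow> nat set" where
  "periods D = {1..NT D}"

definition units_at :: "('i, 'm, 'l, 'k) red_data \<Rightarrow> 'm \<Rightarrow> 'i set" where
  "units_at D m = {i \<in> units D. bus_of D i = m}"

text \<open>Finitely many breakpoints; affine on every interval that avoids all of them.\<close>

definition piecewise_linear :: "(real \<Rightarrow> real) \<Rightarrow> bool" where
  "piecewise_linear f \<longleftrightarrow> continuous_on UNIV f \<and>
     (\<exists>B. finite B \<and> (\<forall>S. is_interval S \<and> S \<inter> B = {} \<longrightarrow>
        (\<exists>a b. \<forall>x\<in>S. f x = a * x + b)))"

definition valid_data :: "('i, 'm, 'l, 'k) red_data \<Rightarrow> bool" where
  "valid_data D \<longleftrightarrow>
     finite (units D) \<and> finite (buses D) \<and> finite (lines D) \<and> finite (scen D) \<and>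
     (\<forall>i\<in>units D. bus_of D i \<in> buses D) \<and>
     (\<forall>l\<in>lines D. 0 \<le> Flim D l) \<and>
     (\<forall>i\<in>units D. 0 \<le> Pmin D i \<and> Pmin D i \<le> Pmax D i \<and>
        0 \<le> ramp_up D i \<and> 0 \<le> ramp_down D i \<and> 0 \<le> Ramp_up D i \<and> 0 \<le> Ramp_down D i) \<and>
     (\<forall>i\<in>units D. convex_on UNIV (gcost D i) \<and> piecewise_linear (gcost D i)) \<and>
     (\<forall>i\<in>units D. \<forall>t\<in>periods D. Ihat D i t \<in> {0, 1} \<and> yhat D i t \<in> {0, 1}) \<and>
     (\<forall>i\<in>units D. \<forall>t\<in>{1..NT D + 1}. zhat D i t \<in> {0, 1})"

text \<open>Primal points: \<open>P i t\<close> is the dispatch and \<open>dP k i t\<close> the redispatch in scenario \<open>k\<close>.\<close>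

definition P_prev :: "('i, 'm, 'l, 'k) red_data \<Rightarrow> ('i \<Rightarrow> nat \<Rightarrow> real) \<Rightarrow> 'i \<Rightarrow> nat \<Rightarrow> real" where
  "P_prev D P i t = (if t = 1 then P0 D i else P i (t - 1))"

definition Pinj :: "('i, 'm, 'l, 'k) red_data \<Rightarrow> ('i \<Rightarrow> nat \<Rightarrow> real) \<Rightarrow> 'm \<Rightarrow> nat \<Rightarrow> real" where
  "Pinj D P m t = (\<Sum>i\<in>units_at D m. P i t) - load D m t"

definition dPinj ::
  "('i, 'm, 'l, 'k) red_data \<Rightarrow> ('k \<Rightarrow> 'i \<Rightarrow> nat \<Rightarrow> real) \<Rightarrow> 'k \<Rightarrow> 'm \<Rightarrow> nat \<Rightarrow> real" where
  "dPinj D dP k m t = (\<Sum>i\<in>units_at D m. dP k i t) - eps D k m t"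

definition flow :: "('i, 'm, 'l, 'k) red_data \<Rightarrow> ('i \<Rightarrow> nat \<Rightarrow> real) \<Rightarrow> 'l \<Rightarrow> nat \<Rightarrow> real" where
  "flow D P l t = (\<Sum>m\<in>buses D. Gam D l m * Pinj D P m t)"

definition flow_k ::
  "('i, 'm, 'l, 'k) red_data \<Rightarrow> ('i \<Rightarrow> nat \<Rightarrow> real) \<Rightarrow> ('k \<Rightarrow> 'i \<Rightarrow> nat \<Rightarrow> real) \<Rightarrow>
   'k \<Rightarrow> 'l \<Rightarrow> nat \<Rightarrow> real" where
  "flow_k D P dP k l t = (\<Sum>m\<in>buses D. Gam D l m * (Pinj D P m t + dPinj D dP k m t))"

definition total_cost :: "('i, 'm, 'l, 'k) red_data \<Rightarrow> ('i \<Rightarrow> nat \<Rightarrow> real) \<Rightarrow> real" where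
  "total_cost D P = (\<Sum>t\<in>periods D. \<Sum>i\<in>units D. gcost D i (P i t))"

text \<open>
  For each inequality constraint, its left side minus its right side. The names are those of the
  multipliers below; the suffix \<open>_k\<close> marks the scenario constraints.
\<close>

definition g_beta_up where
  "g_beta_up D P i t = P i t - Ihat D i t * Pmax D i"
definition g_beta_lo where
  "g_beta_lo D P i t = - P i t - (- (Ihat D i t * Pmin D i))"
definition g_alpha_up where
  "g_alpha_up D P i t =
     (P i t - P_prev D P i t) - (ramp_up D i * (1 - yhat D i t) + Pmin D i * yhat D i t)"
definition g_alpha_lo where
  "g_alpha_lo D P i t =
     (- P i t + P_prev D P i t) - (ramp_down D i * (1 - zhat D i t) + Pmin D i * zhat D i t)"
definition g_eta_up where
  "g_eta_up D P l t = flow D P l t - Flim D l"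
definition g_eta_lo where
  "g_eta_lo D P l t = - flow D P l t - Flim D l"

definition g_beta_up_k where
  "g_beta_up_k D P dP k i t = (P i t + dP k i t) - Ihat D i t * Pmax D i"
definition g_beta_lo_k where
  "g_beta_lo_k D P dP k i t = (- P i t - dP k i t) - (- (Ihat D i t * Pmin D i))"
definition g_alpha_up_k where
  "g_alpha_up_k D dP k i t = dP k i t - Ramp_up D i * (1 - yhat D i t)"
definition g_alpha_lo_k where
  "g_alpha_lo_k D dP k i t = - dP k i t - Ramp_down D i * (1 - zhat D i (t + 1))"
definition g_eta_up_k where
  "g_eta_up_k D P dP k l t = flow_k D P dP k l t - Flim D l"
definition g_eta_lo_k where
  "g_eta_lo_k D P dP k l t = - flow_k D P dP k l t - Flim D l"

definition red_feasible ::
  "('i, 'm, 'l, 'k) red_data \<Rightarrow> ('i \<Rightarrow> nat \<Rightarrow> real) \<Rightarrow> ('k \<Rightarrow> 'i \<Rightarrow> nat \<Rightarrow> real) \<Rightarrow> bool" where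
  "red_feasible D P dP \<longleftrightarrow>
     (\<forall>t\<in>periods D.
        (\<Sum>i\<in>units D. P i t) = (\<Sum>m\<in>buses D. load D m t) \<and>
        (\<forall>i\<in>units D. g_beta_up D P i t \<le> 0 \<and> g_beta_lo D P i t \<le> 0 \<and>
           g_alpha_up D P i t \<le> 0 \<and> g_alpha_lo D P i t \<le> 0) \<and>
        (\<forall>l\<in>lines D. g_eta_up D P l t \<le> 0 \<and> g_eta_lo D P l t \<le> 0) \<and>
        (\<forall>k\<in>scen D.
           (\<Sum>i\<in>units D. dP k i t) = (\<Sum>m\<in>buses D. eps D k m t) \<and>
           (\<forall>i\<in>units D. g_beta_up_k D P dP k i t \<le> 0 \<and> g_beta_lo_k D P dP k i t \<le> 0 \<and>
              g_alpha_up_k D dP k i t \<le> 0 \<and> g_alpha_lo_k D dP k i t \<le> 0) \<and>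
           (\<forall>l\<in>lines D. g_eta_up_k D P dP k l t \<le> 0 \<and> g_eta_lo_k D P dP k l t \<le> 0)))"

definition red_optimal ::
  "('i, 'm, 'l, 'k) red_data \<Rightarrow> ('i \<Rightarrow> nat \<Rightarrow> real) \<Rightarrow> ('k \<Rightarrow> 'i \<Rightarrow> nat \<Rightarrow> real) \<Rightarrow> bool" where
  "red_optimal D P dP \<longleftrightarrow> red_feasible D P dP \<and>
     (\<forall>P' dP'. red_feasible D P' dP' \<longrightarrow> total_cost D P \<le> total_cost D P')"

record ('i, 'l, 'k) multipliers =
  lam :: "nat \<Rightarrow> real"
  beta_up  :: "'i \<Rightarrow> nat \<Rightarrow> real"
  beta_lo  :: "'i \<Rightarrow> nat \<Rightarrow> real"
  alpha_up :: "'i \<Rightarrow> nat \<Rightarrow> real"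
  alpha_lo :: "'i \<Rightarrow> nat \<Rightarrow> real"
  eta_up   :: "'l \<Rightarrow> nat \<Rightarrow> real"
  eta_lo   :: "'l \<Rightarrow> nat \<Rightarrow> real"
  lam_k :: "'k \<Rightarrow> nat \<Rightarrow> real"
  beta_up_k  :: "'k \<Rightarrow> 'i \<Rightarrow> nat \<Rightarrow> real"
  beta_lo_k  :: "'k \<Rightarrow> 'i \<Rightarrow> nat \<Rightarrow> real"
  alpha_up_k :: "'k \<Rightarrow> 'i \<Rightarrow> nat \<Rightarrow> real"
  alpha_lo_k :: "'k \<Rightarrow> 'i \<Rightarrow> nat \<Rightarrow> real"
  eta_up_k   :: "'k \<Rightarrow> 'l \<Rightarrow> nat \<Rightarrow> real"
  eta_lo_k   :: "'k \<Rightarrow> 'l \<Rightarrow> nat \<Rightarrow> real"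

definition lagrangian ::
  "('i, 'm, 'l, 'k) red_data \<Rightarrow> ('i, 'l, 'k) multipliers \<Rightarrow>
   ('i \<Rightarrow> nat \<Rightarrow> real) \<Rightarrow> ('k \<Rightarrow> 'i \<Rightarrow> nat \<Rightarrow> real) \<Rightarrow> real" where
  "lagrangian D M P dP =
     total_cost D P
     + (\<Sum>t\<in>periods D. lam M t * ((\<Sum>m\<in>buses D. load D m t) - (\<Sum>i\<in>units D. P i t)))
     + (\<Sum>t\<in>periods D. \<Sum>i\<in>units D.
          beta_up M i t * g_beta_up D P i t + beta_lo M i t * g_beta_lo D P i t
          + alpha_up M i t * g_alpha_up D P i t + alpha_lo M i t * g_alpha_lo D P i t)
     + (\<Sum>t\<in>periods D. \<Sum>l\<in>lines D.
          eta_up M l t * g_eta_up D P l t + eta_lo M l t * g_eta_lo D P l t)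
     + (\<Sum>k\<in>scen D. \<Sum>t\<in>periods D.
          lam_k M k t * ((\<Sum>m\<in>buses D. eps D k m t) - (\<Sum>i\<in>units D. dP k i t)))
     + (\<Sum>k\<in>scen D. \<Sum>t\<in>periods D. \<Sum>i\<in>units D.
          beta_up_k M k i t * g_beta_up_k D P dP k i t
          + beta_lo_k M k i t * g_beta_lo_k D P dP k i t
          + alpha_up_k M k i t * g_alpha_up_k D dP k i t
          + alpha_lo_k M k i t * g_alpha_lo_k D dP k i t)
     + (\<Sum>k\<in>scen D. \<Sum>t\<in>periods D. \<Sum>l\<in>lines D.
          eta_up_k M k l t * g_eta_up_k D P dP k l t
          + eta_lo_k M k l t * g_eta_lo_k D P dP k l t)"

definition dual_feasible ::
  "('i, 'm, 'l, 'k) red_data \<Rightarrow> ('i, 'l, 'k) multipliers \<Rightarrow> bool" where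
  "dual_feasible D M \<longleftrightarrow>
     (\<forall>t\<in>periods D.
        (\<forall>i\<in>units D. 0 \<le> beta_up M i t \<and> 0 \<le> beta_lo M i t \<and>
           0 \<le> alpha_up M i t \<and> 0 \<le> alpha_lo M i t) \<and>
        (\<forall>l\<in>lines D. 0 \<le> eta_up M l t \<and> 0 \<le> eta_lo M l t) \<and>
        (\<forall>k\<in>scen D.
           (\<forall>i\<in>units D. 0 \<le> beta_up_k M k i t \<and> 0 \<le> beta_lo_k M k i t \<and>
              0 \<le> alpha_up_k M k i t \<and> 0 \<le> alpha_lo_k M k i t) \<and>
           (\<forall>l\<in>lines D. 0 \<le> eta_up_k M k l t \<and> 0 \<le> eta_lo_k M k l t)))"

definition complementary_slackness ::
  "('i, 'm, 'l, 'k) red_data \<Rightarrow> ('i, 'l, 'k) multipliers \<Rightarrow>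
   ('i \<Rightarrow> nat \<Rightarrow> real) \<Rightarrow> ('k \<Rightarrow> 'i \<Rightarrow> nat \<Rightarrow> real) \<Rightarrow> bool" where
  "complementary_slackness D M P dP \<longleftrightarrow>
     (\<forall>t\<in>periods D.
        (\<forall>i\<in>units D.
           beta_up M i t * g_beta_up D P i t = 0 \<and> beta_lo M i t * g_beta_lo D P i t = 0 \<and>
           alpha_up M i t * g_alpha_up D P i t = 0 \<and> alpha_lo M i t * g_alpha_lo D P i t = 0) \<and>
        (\<forall>l\<in>lines D.
           eta_up M l t * g_eta_up D P l t = 0 \<and> eta_lo M l t * g_eta_lo D P l t = 0) \<and>
        (\<forall>k\<in>scen D.
           (\<forall>i\<in>units D.
              beta_up_k M k i t * g_beta_up_k D P dP k i t = 0 \<and>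
              beta_lo_k M k i t * g_beta_lo_k D P dP k i t = 0 \<and>
              alpha_up_k M k i t * g_alpha_up_k D dP k i t = 0 \<and>
              alpha_lo_k M k i t * g_alpha_lo_k D dP k i t = 0) \<and>
           (\<forall>l\<in>lines D.
              eta_up_k M k l t * g_eta_up_k D P dP k l t = 0 \<and>
              eta_lo_k M k l t * g_eta_lo_k D P dP k l t = 0)))"

text \<open>
  The cost need not be differentiable, so stationarity says that zero is a subgradient of the
  (convex) Lagrangian at \<open>(P, dP)\<close>, i.e. that \<open>(P, dP)\<close> minimises it without constraints.
\<close>

definition stationary ::
  "('i, 'm, 'l, 'k) red_data \<Rightarrow> ('i, 'l, 'k) multipliers \<Rightarrow>
   ('i \<Rightarrow> nat \<Rightarrow> real) \<Rightarrow> ('k \<Rightarrow> 'i \<Rightarrow> nat \<Rightarrow> real) \<Rightarrow> bool" where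
  "stationary D M P dP \<longleftrightarrow> (\<forall>P' dP'. lagrangian D M P dP \<le> lagrangian D M P' dP')"

definition kkt_multipliers ::
  "('i, 'm, 'l, 'k) red_data \<Rightarrow> ('i \<Rightarrow> nat \<Rightarrow> real) \<Rightarrow> ('k \<Rightarrow> 'i \<Rightarrow> nat \<Rightarrow> real) \<Rightarrow>
   ('i, 'l, 'k) multipliers \<Rightarrow> bool" where
  "kkt_multipliers D P dP M \<longleftrightarrow>
     red_feasible D P dP \<and> dual_feasible D M \<and>
     complementary_slackness D M P dP \<and> stationary D M P dP"

text \<open>Energy price (LMP) and uncertainty marginal price (UMP).\<close>

definition price_e ::
  "('i, 'm, 'l, 'k) red_data \<Rightarrow> ('i, 'l, 'k) multipliers \<Rightarrow> 'm \<Rightarrow> nat \<Rightarrow> real" where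
  "price_e D M m t = lam M t
     - (\<Sum>l\<in>lines D. Gam D l m * (eta_up M l t - eta_lo M l t))
     - (\<Sum>l\<in>lines D. \<Sum>k\<in>scen D. Gam D l m * (eta_up_k M k l t - eta_lo_k M k l t))"

definition price_u ::
  "('i, 'm, 'l, 'k) red_data \<Rightarrow> ('i, 'l, 'k) multipliers \<Rightarrow> 'k \<Rightarrow> 'm \<Rightarrow> nat \<Rightarrow> real" where
  "price_u D M k m t = lam_k M k t
     - (\<Sum>l\<in>lines D. Gam D l m * (eta_up_k M k l t - eta_lo_k M k l t))"

definition uncertainty_payment ::
  "('i, 'm, 'l, 'k) red_data \<Rightarrow> ('i, 'l, 'k) multipliers \<Rightarrow> 'm \<Rightarrow> nat \<Rightarrow> real" where
  "uncertainty_payment D M m t = (\<Sum>k\<in>scen D. price_u D M k m t * eps D k m t)"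

definition gen_reserve_credit ::
  "('i, 'm, 'l, 'k) red_data \<Rightarrow> ('i, 'l, 'k) multipliers \<Rightarrow> ('k \<Rightarrow> 'i \<Rightarrow> nat \<Rightarrow> real) \<Rightarrow>
   'i \<Rightarrow> nat \<Rightarrow> real" where
  "gen_reserve_credit D M dP i t = (\<Sum>k\<in>scen D. price_u D M k (bus_of D i) t * dP k i t)"

definition df_pos :: "('i, 'm, 'l, 'k) red_data \<Rightarrow> ('i \<Rightarrow> nat \<Rightarrow> real) \<Rightarrow> 'l \<Rightarrow> nat \<Rightarrow> real" where
  "df_pos D P l t = Flim D l - flow D P l t"

definition df_neg :: "('i, 'm, 'l, 'k) red_data \<Rightarrow> ('i \<Rightarrow> nat \<Rightarrow> real) \<Rightarrow> 'l \<Rightarrow> nat \<Rightarrow> real" where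
  "df_neg D P l t = Flim D l + flow D P l t"

definition trans_reserve_credit ::
  "('i, 'm, 'l, 'k) red_data \<Rightarrow> ('i, 'l, 'k) multipliers \<Rightarrow> ('i \<Rightarrow> nat \<Rightarrow> real) \<Rightarrow>
   'l \<Rightarrow> nat \<Rightarrow> real" where
  "trans_reserve_credit D M P l t =
     (\<Sum>k\<in>scen D. eta_up_k M k l t * df_pos D P l t + eta_lo_k M k l t * df_neg D P l t)"

text \<open>\<open>ftr m n\<close> is the amount held from bus \<open>m\<close> to bus \<open>n\<close>; it may have either sign.\<close>

definition ftr_credit ::
  "('i, 'm, 'l, 'k) red_data \<Rightarrow> ('i, 'l, 'k) multipliers \<Rightarrow> ('m \<Rightarrow> 'm \<Rightarrow> real) \<Rightarrow>
   nat \<Rightarrow> real" where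
  "ftr_credit D M ftr t =
     (\<Sum>(m, n)\<in>buses D \<times> buses D. (price_e D M m t - price_e D M n t) * ftr m n)"

definition sft :: "('i, 'm, 'l, 'k) red_data \<Rightarrow> ('m \<Rightarrow> 'm \<Rightarrow> real) \<Rightarrow> bool" where
  "sft D ftr \<longleftrightarrow>
     (\<forall>l\<in>lines D.
        - Flim D l \<le> (\<Sum>(m, n)\<in>buses D \<times> buses D. (Gam D l m - Gam D l n) * ftr m n) \<and>
        (\<Sum>(m, n)\<in>buses D \<times> buses D. (Gam D l m - Gam D l n) * ftr m n) \<le> Flim D l)"

end

theory Submission
  imports Defs
begin

text \<open>
  A price of the form \<open>\<lambda> - (\<Sum>l. \<Gamma>\<^sub>l\<^sub>m \<mu>\<^sub>l)\<close>, paired with balanced injections, collapses to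
  minus the congestion rent \<open>\<Sum>l. \<mu>\<^sub>l f\<^sub>l\<close>, where \<open>f\<^sub>l\<close> is the flow induced on line \<open>l\<close>. For the
  uncertainty prices and the injections \<open>\<Delta>P\<^sup>i\<^sup>n\<^sup>j\<close>, complementary slackness turns this rent into
  the transmission reserve credit, which is the first claim. For the energy prices it shows that
  the surplus before paying FTR holders is \<open>\<Sum>l. w\<^sub>l F\<^sub>l\<close>, where \<open>w\<^sub>l\<close> is the sum of all
  congestion multipliers of the line; the test bounds the FTR credit by the same amount.
\<close>

lemma sum_congestion_price_mult:
  fixes c :: "'a::comm_ring"
  shows "(\<Sum>m\<in>A. (c - (\<Sum>l\<in>L. G l m * mu l)) * q m)
       = c * sum q A - (\<Sum>l\<in>L. mu l * (\<Sum>m\<in>A. G l m * q m))"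
proof -
  have "(\<Sum>m\<in>A. (\<Sum>l\<in>L. G l m * mu l) * q m) = (\<Sum>l\<in>L. mu l * (\<Sum>m\<in>A. G l m * q m))"
    unfolding sum_distrib_left sum_distrib_right
    by (subst sum.swap) (simp add: ac_simps)
  then show ?thesis
    by (simp add: left_diff_distrib sum_subtractf sum_distrib_left)
qed

lemma sum_congestion_price_diff_mult:
  fixes c :: "'a::comm_ring"
  shows "(\<Sum>(m, n)\<in>S. ((c - (\<Sum>l\<in>L. G l m * mu l)) - (c - (\<Sum>l\<in>L. G l n * mu l))) * q m n)
       = - (\<Sum>l\<in>L. mu l * (\<Sum>(m, n)\<in>S. (G l m - G l n) * q m n))"
proof -
  have "(\<Sum>(m, n)\<in>S. ((c - (\<Sum>l\<in>L. G l m * mu l)) - (c - (\<Sum>l\<in>L. G l n * mu l))) * q m n)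
      = (\<Sum>s\<in>S. (0 - (\<Sum>l\<in>L. (G l (fst s) - G l (snd s)) * mu l)) * q (fst s) (snd s))"
    by (simp add: case_prod_unfold left_diff_distrib sum_subtractf)
  also have "\<dots> = - (\<Sum>l\<in>L. mu l * (\<Sum>(m, n)\<in>S. (G l m - G l n) * q m n))"
    by (subst sum_congestion_price_mult) (simp add: case_prod_unfold)
  finally show ?thesis .
qed

text \<open>\<open>bus_of\<close> sends every unit into \<open>buses D\<close>, so the sets
  \<open>units_at D m\<close> partition the units.\<close>

lemma sum_buses_units_at:
  assumes "valid_data D"
  shows "(\<Sum>m\<in>buses D. \<Sum>i\<in>units_at D m. h i) = (\<Sum>i\<in>units D. h i)"
  unfolding units_at_def
  by (rule sum.group) (use assms in \<open>auto simp: valid_data_def\<close>)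

lemma sum_price_injection:
  fixes p :: "'m \<Rightarrow> real"
  assumes "valid_data D"
  shows "(\<Sum>m\<in>buses D. p m * ((\<Sum>i\<in>units_at D m. x i) - e m))
       = (\<Sum>i\<in>units D. p (bus_of D i) * x i) - (\<Sum>m\<in>buses D. p m * e m)"
proof -
  have "(\<Sum>m\<in>buses D. p m * (\<Sum>i\<in>units_at D m. x i))
      = (\<Sum>m\<in>buses D. \<Sum>i\<in>units_at D m. p (bus_of D i) * x i)"
    by (simp add: sum_distrib_left units_at_def)
  then show ?thesis
    by (simp add: right_diff_distrib sum_subtractf sum_buses_units_at[OF assms])
qed

text \<open>The coefficient of \<open>flow D P l t\<close> in the Lagrangian. The scenario
  multipliers contribute because each \<open>flow_k\<close> contains the base flow.\<close>

definition congestion ::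
  "('i, 'm, 'l, 'k) red_data \<Rightarrow> ('i, 'l, 'k) multipliers \<Rightarrow> 'l \<Rightarrow> nat \<Rightarrow> real" where
  "congestion D M l t = (eta_up M l t - eta_lo M l t)
     + (\<Sum>k\<in>scen D. eta_up_k M k l t - eta_lo_k M k l t)"

text \<open>Up to sign, the coefficient of \<open>Flim D l\<close> at time \<open>t\<close> in the
  Lagrangian: opposite limits add up here, whereas in \<open>congestion\<close> they offset each
  other.\<close>

definition congestion_weight ::
  "('i, 'm, 'l, 'k) red_data \<Rightarrow> ('i, 'l, 'k) multipliers \<Rightarrow> 'l \<Rightarrow> nat \<Rightarrow> real" where
  "congestion_weight D M l t = (eta_up M l t + eta_lo M l t)
     + (\<Sum>k\<in>scen D. eta_up_k M k l t + eta_lo_k M k l t)"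

lemma price_e_congestion:
  "price_e D M m t = lam M t - (\<Sum>l\<in>lines D. Gam D l m * congestion D M l t)"
  by (simp add: price_e_def congestion_def distrib_left sum.distrib flip: sum_distrib_left)

lemma abs_congestion_le_weight:
  assumes "dual_feasible D M" "l \<in> lines D" "t \<in> periods D"
  shows "\<bar>congestion D M l t\<bar> \<le> congestion_weight D M l t"
proof -
  have "\<bar>\<Sum>k\<in>scen D. eta_up_k M k l t - eta_lo_k M k l t\<bar>
      \<le> (\<Sum>k\<in>scen D. eta_up_k M k l t + eta_lo_k M k l t)"
    by (rule order_trans[OF sum_abs sum_mono]) (use assms in \<open>force simp: dual_feasible_def\<close>)
  moreover have "0 \<le> eta_up M l t" "0 \<le> eta_lo M l t"
    using assms by (auto simp: dual_feasible_def)
  ultimately show ?thesis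
    unfolding congestion_def congestion_weight_def by linarith
qed

lemma sum_Pinj:
  assumes "valid_data D" "red_feasible D P dP" "t \<in> periods D"
  shows "(\<Sum>m\<in>buses D. Pinj D P m t) = 0"
  using assms(2,3)
  by (simp add: Pinj_def sum_subtractf sum_buses_units_at[OF assms(1)] red_feasible_def)

lemma sum_dPinj:
  assumes "valid_data D" "red_feasible D P dP" "t \<in> periods D" "k \<in> scen D"
  shows "(\<Sum>m\<in>buses D. dPinj D dP k m t) = 0"
  using assms(2-)
  by (simp add: dPinj_def sum_subtractf sum_buses_units_at[OF assms(1)] red_feasible_def)

lemma uncertainty_balance_scenario:
  assumes "valid_data D" "red_feasible D P dP" "complementary_slackness D M P dP"
    and "t \<in> periods D" "k \<in> scen D"
  shows "(\<Sum>m\<in>buses D. price_u D M k m t * eps D k m t)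
       = (\<Sum>i\<in>units D. price_u D M k (bus_of D i) t * dP k i t)
       + (\<Sum>l\<in>lines D. eta_up_k M k l t * df_pos D P l t + eta_lo_k M k l t * df_neg D P l t)"
proof -
  \<comment> \<open>A positive upper multiplier forces \<open>flow_k\<close> to equal
    \<open>Flim\<close>, so the redispatch flow \<open>flow_k - flow\<close> is
    \<open>df_pos\<close>. A positive lower one forces \<open>flow_k\<close> to equal
    \<open>- Flim\<close>, so it is \<open>- df_neg\<close>.\<close>
  have rent: "(eta_up_k M k l t - eta_lo_k M k l t) * (\<Sum>m\<in>buses D. Gam D l m * dPinj D dP k m t)
      = eta_up_k M k l t * df_pos D P l t + eta_lo_k M k l t * df_neg D P l t"
    if "l \<in> lines D" for l
  proof -
    have "(\<Sum>m\<in>buses D. Gam D l m * dPinj D dP k m t) = flow_k D P dP k l t - flow D P l t"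
      by (simp add: flow_k_def flow_def distrib_left sum.distrib)
    moreover have "eta_up_k M k l t * (flow_k D P dP k l t - Flim D l) = 0"
      "eta_lo_k M k l t * (- flow_k D P dP k l t - Flim D l) = 0"
      using assms(3-) that
      by (auto simp: complementary_slackness_def g_eta_up_k_def g_eta_lo_k_def)
    ultimately show ?thesis
      unfolding df_pos_def df_neg_def by algebra
  qed
  have "(\<Sum>i\<in>units D. price_u D M k (bus_of D i) t * dP k i t)
        - (\<Sum>m\<in>buses D. price_u D M k m t * eps D k m t)
      = (\<Sum>m\<in>buses D. price_u D M k m t * dPinj D dP k m t)"
    unfolding dPinj_def by (rule sum_price_injection[OF assms(1), symmetric])
  also have "\<dots> = - (\<Sum>l\<in>lines D. (eta_up_k M k l t - eta_lo_k M k l t)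
                      * (\<Sum>m\<in>buses D. Gam D l m * dPinj D dP k m t))"
    by (simp add: price_u_def sum_congestion_price_mult sum_dPinj[OF assms(1,2,4,5)])
  also have "\<dots> = - (\<Sum>l\<in>lines D. eta_up_k M k l t * df_pos D P l t
                      + eta_lo_k M k l t * df_neg D P l t)"
    by (simp add: rent)
  finally show ?thesis by simp
qed

lemma uncertainty_balance:
  assumes "valid_data D" "red_feasible D P dP" "complementary_slackness D M P dP"
    and "t \<in> periods D"
  shows "(\<Sum>m\<in>buses D. uncertainty_payment D M m t)
       = (\<Sum>i\<in>units D. gen_reserve_credit D M dP i t)
       + (\<Sum>l\<in>lines D. trans_reserve_credit D M P l t)"
proof -
  have "(\<Sum>m\<in>buses D. uncertainty_payment D M m t)
      = (\<Sum>k\<in>scen D. \<Sum>m\<in>buses D. price_u D M k m t * eps D k m t)"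
    unfolding uncertainty_payment_def by (rule sum.swap)
  also have "\<dots> = (\<Sum>k\<in>scen D. \<Sum>i\<in>units D. price_u D M k (bus_of D i) t * dP k i t)
      + (\<Sum>k\<in>scen D. \<Sum>l\<in>lines D. eta_up_k M k l t * df_pos D P l t + eta_lo_k M k l t * df_neg D P l t)"
    by (simp add: uncertainty_balance_scenario[OF assms] flip: sum.distrib)
  also have "(\<Sum>k\<in>scen D. \<Sum>i\<in>units D. price_u D M k (bus_of D i) t * dP k i t)
      = (\<Sum>i\<in>units D. gen_reserve_credit D M dP i t)"
    unfolding gen_reserve_credit_def by (rule sum.swap)
  also have "(\<Sum>k\<in>scen D. \<Sum>l\<in>lines D. eta_up_k M k l t * df_pos D P l t + eta_lo_k M k l t * df_neg D P l t)
      = (\<Sum>l\<in>lines D. trans_reserve_credit D M P l t)"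
    unfolding trans_reserve_credit_def by (rule sum.swap)
  finally show ?thesis .
qed

text \<open>The energy surplus is the congestion rent on base flows. Scenario multipliers may be
  positive where the base flow is below its limit; the transmission reserve credit pays for exactly
  this gap and lifts the rent to full line limits.\<close>

lemma energy_balance:
  assumes "valid_data D" "red_feasible D P dP" "complementary_slackness D M P dP"
    and "t \<in> periods D"
  shows "(\<Sum>m\<in>buses D. price_e D M m t * load D m t) + (\<Sum>l\<in>lines D. trans_reserve_credit D M P l t)
       = (\<Sum>i\<in>units D. price_e D M (bus_of D i) t * P i t)
       + (\<Sum>l\<in>lines D. congestion_weight D M l t * Flim D l)"
proof -
  have rent: "congestion D M l t * flow D P l t + trans_reserve_credit D M P l t
      = congestion_weight D M l t * Flim D l" if "l \<in> lines D" for l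
  proof -
    have "eta_up M l t * (flow D P l t - Flim D l) = 0"
      "eta_lo M l t * (- flow D P l t - Flim D l) = 0"
      using assms(3-) that
      by (auto simp: complementary_slackness_def g_eta_up_def g_eta_lo_def)
    then have "(eta_up M l t - eta_lo M l t) * flow D P l t = (eta_up M l t + eta_lo M l t) * Flim D l"
      by algebra
    \<comment> \<open>An identity in the multipliers: with upper and lower multipliers
      \<open>a\<close> and \<open>b\<close>, flow \<open>f\<close> and limit \<open>F\<close>,
      \<open>(a - b) * f + a * (F - f) + b * (F + f) = (a + b) * F\<close>.\<close>
    moreover have "(\<Sum>k\<in>scen D. eta_up_k M k l t - eta_lo_k M k l t) * flow D P l t
        + trans_reserve_credit D M P l t
        = (\<Sum>k\<in>scen D. eta_up_k M k l t + eta_lo_k M k l t) * Flim D l"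
      unfolding trans_reserve_credit_def df_pos_def df_neg_def sum_distrib_right sum.distrib[symmetric]
      by (intro sum.cong refl) (simp add: algebra_simps)
    ultimately show ?thesis
      by (simp add: congestion_def congestion_weight_def distrib_right)
  qed
  have "(\<Sum>i\<in>units D. price_e D M (bus_of D i) t * P i t)
        - (\<Sum>m\<in>buses D. price_e D M m t * load D m t)
      = (\<Sum>m\<in>buses D. price_e D M m t * Pinj D P m t)"
    unfolding Pinj_def by (rule sum_price_injection[OF assms(1), symmetric])
  also have "\<dots> = - (\<Sum>l\<in>lines D. congestion D M l t * flow D P l t)"
    by (simp add: price_e_congestion sum_congestion_price_mult flow_def sum_Pinj[OF assms(1,2,4)])
  moreover have "(\<Sum>l\<in>lines D. congestion D M l t * flow D P l t)
        + (\<Sum>l\<in>lines D. trans_reserve_credit D M P l t)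
      = (\<Sum>l\<in>lines D. congestion_weight D M l t * Flim D l)"
    by (simp add: rent flip: sum.distrib)
  ultimately show ?thesis by linarith
qed

lemma ftr_credit_le:
  assumes "dual_feasible D M" "sft D ftr" "t \<in> periods D"
  shows "ftr_credit D M ftr t \<le> (\<Sum>l\<in>lines D. congestion_weight D M l t * Flim D l)"
proof -
  \<comment> \<open>\<open>g l\<close> is the flow on line \<open>l\<close> when every right is
    injected at its source bus and withdrawn at its sink; the test says that these flows respect the
    line limits.\<close>
  define g where "g l = (\<Sum>(m, n)\<in>buses D \<times> buses D. (Gam D l m - Gam D l n) * ftr m n)" for l
  have "ftr_credit D M ftr t = - (\<Sum>l\<in>lines D. congestion D M l t * g l)"
    unfolding ftr_credit_def price_e_congestion g_def by (rule sum_congestion_price_diff_mult)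
  also have "\<dots> \<le> (\<Sum>l\<in>lines D. \<bar>congestion D M l t * g l\<bar>)"
    by (rule order_trans[OF abs_ge_minus_self sum_abs])
  also have "\<dots> \<le> (\<Sum>l\<in>lines D. congestion_weight D M l t * Flim D l)"
  proof (rule sum_mono)
    fix l assume l: "l \<in> lines D"
    have "\<bar>g l\<bar> \<le> Flim D l"
      using assms(2) l unfolding sft_def g_def by (auto simp: abs_le_iff)
    then show "\<bar>congestion D M l t * g l\<bar> \<le> congestion_weight D M l t * Flim D l"
      using abs_congestion_le_weight[OF assms(1) l assms(3)] unfolding abs_mult
      by (intro mult_mono) auto
  qed
  finally show ?thesis .
qed

theorem theorem2:
  fixes D :: "('i, 'm, 'l, 'k) red_data"
    and P :: "'i \<Rightarrow> nat \<Rightarrow> real"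
    and dP :: "'k \<Rightarrow> 'i \<Rightarrow> nat \<Rightarrow> real"
    and M :: "('i, 'l, 'k) multipliers"
  assumes data: "valid_data D"
    and feasible: "\<exists>P' dP'. red_feasible D P' dP'"
    and optimal: "red_optimal D P dP"
    and multipliers: "kkt_multipliers D P dP M"
  shows "(\<Sum>m\<in>buses D. \<Sum>t\<in>periods D. uncertainty_payment D M m t)
       = (\<Sum>i\<in>units D. \<Sum>t\<in>periods D. gen_reserve_credit D M dP i t)
       + (\<Sum>l\<in>lines D. \<Sum>t\<in>periods D. trans_reserve_credit D M P l t)
    \<and> (\<forall>ftr. sft D ftr \<longrightarrow>
         (\<Sum>m\<in>buses D. \<Sum>t\<in>periods D. price_e D M m t * load D m t)
       + (\<Sum>m\<in>buses D. \<Sum>t\<in>periods D. uncertainty_payment D M m t)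
       \<ge> (\<Sum>i\<in>units D. \<Sum>t\<in>periods D. price_e D M (bus_of D i) t * P i t)
       + (\<Sum>i\<in>units D. \<Sum>t\<in>periods D. gen_reserve_credit D M dP i t)
       + (\<Sum>t\<in>periods D. ftr_credit D M ftr t))"
proof -
  from multipliers have kkt: "red_feasible D P dP" "complementary_slackness D M P dP"
    and dual: "dual_feasible D M"
    by (auto simp: kkt_multipliers_def)
  have "(\<Sum>t\<in>periods D. \<Sum>m\<in>buses D. uncertainty_payment D M m t)
      = (\<Sum>t\<in>periods D. \<Sum>i\<in>units D. gen_reserve_credit D M dP i t)
      + (\<Sum>t\<in>periods D. \<Sum>l\<in>lines D. trans_reserve_credit D M P l t)"
    by (simp add: uncertainty_balance[OF data kkt] flip: sum.distrib)
  then have payment: "(\<Sum>m\<in>buses D. \<Sum>t\<in>periods D. uncertainty_payment D M m t)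
      = (\<Sum>i\<in>units D. \<Sum>t\<in>periods D. gen_reserve_credit D M dP i t)
      + (\<Sum>l\<in>lines D. \<Sum>t\<in>periods D. trans_reserve_credit D M P l t)"
    \<comment> \<open>Fixing the inner index set orients the swap: time sums only move outwards, so
      the rewriting terminates.\<close>
    by (simp only: sum.swap[where B = "periods D"])
  \<comment> \<open>By \<open>payment\<close>, the transmission reserve credit is the uncertainty
    payment left after crediting generation reserves. It is what helps the energy surplus to fund
    the rights.\<close>
  have adequate: "(\<Sum>m\<in>buses D. \<Sum>t\<in>periods D. price_e D M m t * load D m t)
      + (\<Sum>l\<in>lines D. \<Sum>t\<in>periods D. trans_reserve_credit D M P l t)
      \<ge> (\<Sum>i\<in>units D. \<Sum>t\<in>periods D. price_e D M (bus_of D i) t * P i t)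
      + (\<Sum>t\<in>periods D. ftr_credit D M ftr t)" if "sft D ftr" for ftr
  proof -
    have "(\<Sum>t\<in>periods D. (\<Sum>i\<in>units D. price_e D M (bus_of D i) t * P i t) + ftr_credit D M ftr t)
        \<le> (\<Sum>t\<in>periods D. (\<Sum>m\<in>buses D. price_e D M m t * load D m t)
              + (\<Sum>l\<in>lines D. trans_reserve_credit D M P l t))"
      by (rule sum_mono) (simp add: energy_balance[OF data kkt] ftr_credit_le[OF dual that])
    then show ?thesis
      by (simp only: sum.distrib sum.swap[where B = "periods D"])
  qed
  show ?thesis
    using payment adequate by force
qed

end
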